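(* Consider the $T_{ANB}$ model with parameters $c_1,c_2,c_3>0$, $k>0$, $l\in[0,1]$ such that $E_2$ has strictly positive coordinates. The bifurcation parameter surface of the period-doubling bifurcation at $E_2$ is $PD_{ANB}=0$. Furthermore, if a period-doubling bifurcation takes place at $E_2$, the following transversality condition should be satisfied: $$PT_{ANB}^k\neq0,\quad PT_{ANB}^l\neq0,\quad PT_{ANB}^{c_1}\neq0,\quad PT_{ANB}^{c_2}\neq0,\quad PT_{ANB}^{c_3}\neq0.$$ Here $$\begin{aligned}PD_{ANB}={}&klc_3^4+(2c_1kl-10c_2kl-12c_1k-2l)c_3^3\\&+(-12c_1c_2kl+4c_2^2kl+4c_1^2k+116c_1c_2k+2c_1l+2c_2l)c_3^2\\&+(-2c_1^3kl+6c_1^2c_2kl+18c_1c_2^2kl+10c_2^3kl+12c_1^3k-104c_1^2c_2k-116c_1c_2^2k\\&\quad+10c_1^2l-44c_1c_2l+10c_2^2l+64c_1c_2)c_3\\&-c_1^4kl+8c_1^3c_2kl+14c_1^2c_2^2kl-5c_2^4kl-4c_1^4k+4c_1^3c_2k+20c_1^2c_2^2k+12c_1c_2^3k\\&+6c_1^3l-46c_1^2c_2l-46c_1c_2^2l+6c_2^3l+64c_1^2c_2+64c_1c_2^2,\end{aligned}$$ $$\begin{aligned}PT_{ANB}^k={}&lc_3^3+(3c_1l-9c_2l-12c_1)c_3^2+(3c_1^2l-18c_1c_2l-5c_2^2l-8c_1^2+104c_1c_2)c_3\\&+c_1^3l-9c_1^2c_2l-5c_1c_2^2l+5c_2^3l+4c_1^3-8c_1^2c_2-12c_1c_2^2,\end{aligned}$$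 $$\begin{aligned}PT_{ANB}^l={}&kc_3^3+(c_1k-11c_2k-2)c_3^2+(-c_1^2k-2c_1c_2k+15c_2^2k+4c_1+4c_2)c_3\\&-c_1^3k+9c_1^2c_2k+5c_1c_2^2k-5c_2^3k+6c_1^2-52c_1c_2+6c_2^2,\end{aligned}$$ $$\begin{aligned}PT_{ANB}^{c_1}={}&kc_3^3+(-c_1k-11c_2k-2)c_3^2+(-c_1^2k+14c_1c_2k+15c_2^2k-4c_1+4c_2)c_3\\&+c_1^3k-3c_1^2c_2k-9c_1c_2^2k-5c_2^3k-2c_1^2+4c_1c_2+6c_2^2,\end{aligned}$$ $$\begin{aligned}PT_{ANB}^{c_2}={}&(kl+4k)c_1^3+(c_2kl+c_3kl+8c_2k-16c_3k-6l)c_1^2\\&+(-c_2^2kl+2c_2c_3kl-c_3^2kl+4c_2^2k-16c_2c_3k+12c_3^2k-4c_2l-4c_3l)c_1\\&-c_2^3kl+c_2^2c_3kl+c_2c_3^2kl-c_3^3kl+2c_2^2l+4c_2c_3l+2c_3^2l,\end{aligned}$$ $$PT_{ANB}^{c_3}=lc_3^2+(-2c_1l-2c_2l)c_3-3c_1^2l+26c_1c_2l-3c_2^2l-32c_1c_2.$$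
   Context: The $T_{ANB}$ model is the 3-dimensional discrete dynamical system $$\begin{aligned}x(t+1)&=(1-l)x(t)+l\left[\sqrt{\tfrac{y(t)+z(t)}{c_1}}-y(t)-z(t)\right],\\ y(t+1)&=\sqrt{\tfrac{x(t)+z(t)}{c_2}}-x(t)-z(t),\\ z(t+1)&=z(t)+kz(t)\left[\tfrac{x(t)+y(t)}{(x(t)+y(t)+z(t))^2}-c_3\right],\end{aligned}$$ with equilibrium $$E_2=\left(\frac{2(c_2+c_3-c_1)}{(c_1+c_2+c_3)^2},\frac{2(c_1+c_3-c_2)}{(c_1+c_2+c_3)^2},\frac{2(c_1+c_2-c_3)}{(c_1+c_2+c_3)^2}\right).$$ Write $\boldsymbol u=(k,l,c_1,c_2,c_3)$ for the parameters and let $\lambda^3+a_2\lambda^2+a_1\lambda+a_0$, with $a_i=a_i(\boldsymbol u)$, be the characteristic polynomial of the Jacobian matrix of the iteration map at $E_2$. A period-doubling (flip) bifurcation takes place at a parameter point $\overline{\boldsymbol u}$ if and only if: (1) eigenvalue assignment: the Jacobian matrix at the equilibrium has one real eigenvalue $\lambda_1(\overline{\boldsymbol u})=-1$ and all other eigenvalues satisfy $|\lambda_j(\overline{\boldsymbol u})|<1$; (2) transversality: $\partial|\lambda_1(\boldsymbol u)|/\partial u_j\neq0$ at $\boldsymbol u=\overline{\boldsymbol u}$ for every parameter $u_j$. In terms of the coefficients, the criterion used is: $1+a_2+a_1+a_0>0$, $-1+a_2-a_1+a_0=0$, $-a_0^2-a_0a_2+a_1+1>0$, $-a_0^2+a_0a_2-a_1+1>0$,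 and $$\frac{\partial a_0/\partial u_j-\partial a_1/\partial u_j+\partial a_2/\partial u_j}{3-2a_2+a_1}\neq0\quad\text{for every parameter }u_j,$$ where $\partial a_i/\partial u_j$ is the partial derivative of $a_i(\boldsymbol u)$ with respect to $u_j$. The bifurcation parameter surface of the period-doubling bifurcation is the surface in parameter space determined by $-1+a_2-a_1+a_0=0$ at $E_2$. *)

theory Defs
  imports "HOL-Analysis.Analysis" "HOL-Computational_Algebra.Computational_Algebra"
begin

definition charpoly :: "'a::comm_ring_1^'n^'n \<Rightarrow> 'a poly" where
  "charpoly A = det (mat [:0, 1:] - map_matrix (\<lambda>a. [:a:]) A)"

text \<open>The complex eigenvalues of a real matrix, counted with algebraic multiplicity.\<close>

definition eigenvalues :: "real^'n^'n \<Rightarrow> complex multiset" where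
  "eigenvalues A = proots (map_poly complex_of_real (charpoly A))"

text \<open>
  A parameter-dependent system consists of iteration maps \<open>F u\<close> and an equilibrium \<open>E u\<close>
  for each parameter \<open>u\<close>. The Jacobian matrix is taken with respect to the state, at \<open>E u\<close>;
  it depends on \<open>u\<close> both through \<open>F\<close> and through \<open>E\<close>.
\<close>

definition eq_jacobian :: "('p \<Rightarrow> real^'n \<Rightarrow> real^'n) \<Rightarrow> ('p \<Rightarrow> real^'n) \<Rightarrow> 'p \<Rightarrow> real^'n^'n" where
  "eq_jacobian F E u = jacobian (F u) (at (E u))"

definition flip_eigenvalue_assignment :: "real^'n^'n \<Rightarrow> bool" where
  "flip_eigenvalue_assignment A \<longleftrightarrow>
     (\<exists>M. eigenvalues A = add_mset (-1) M \<and> (\<forall>z\<in>#M. cmod z < 1))"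

text \<open>
  Here \<open>\<mu>\<close> is the eigenvalue of \<open>J v\<close> that passes through \<open>-1\<close> at \<open>v = u\<close>. When \<open>J\<close> depends
  continuously on the parameter and \<open>-1\<close> is a simple eigenvalue of \<open>J u\<close>, continuity determines
  \<open>\<mu>\<close> near \<open>u\<close>, so the existential quantifier involves no choice. The unit vectors in
  \<open>Basis\<close> are the directions of the individual parameters.
\<close>

definition flip_transversality :: "('p::euclidean_space \<Rightarrow> real^'n^'n) \<Rightarrow> 'p \<Rightarrow> bool" where
  "flip_transversality J u \<longleftrightarrow>
     (\<exists>\<mu> :: 'p \<Rightarrow> real.
        \<mu> u = -1 \<and> isCont \<mu> u \<and>
        (\<forall>\<^sub>F v in nhds u. complex_of_real (\<mu> v) \<in># eigenvalues (J v)) \<and>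
        (\<forall>b\<in>Basis. \<exists>D. D \<noteq> 0 \<and>
           ((\<lambda>t. \<bar>\<mu> (u + t *\<^sub>R b)\<bar>) has_real_derivative D) (at 0)))"

definition flip_bifurcation ::
  "('p::euclidean_space \<Rightarrow> real^'n \<Rightarrow> real^'n) \<Rightarrow> ('p \<Rightarrow> real^'n) \<Rightarrow> 'p \<Rightarrow> bool" where
  "flip_bifurcation F E u \<longleftrightarrow>
     flip_eigenvalue_assignment (eq_jacobian F E u) \<and>
     flip_transversality (eq_jacobian F E) u"

definition flip_surface ::
  "('p \<Rightarrow> real^3 \<Rightarrow> real^3) \<Rightarrow> ('p \<Rightarrow> real^3) \<Rightarrow> 'p set \<Rightarrow> 'p set" where
  "flip_surface F E U =
     {u \<in> U. let a = coeff (charpoly (eq_jacobian F E u)) in -1 + a 2 - a 1 + a 0 = 0}"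

text \<open>The parameter vector is \<open>(k, l, c\<^sub>1, c\<^sub>2, c\<^sub>3)\<close>.\<close>

type_synonym params = "real \<times> real \<times> real \<times> real \<times> real"

fun T_ANB :: "params \<Rightarrow> real^3 \<Rightarrow> real^3" where
  "T_ANB (k, l, c1, c2, c3) v =
     (let x = v $ 1; y = v $ 2; z = v $ 3 in
      vector
        [(1 - l) * x + l * (sqrt ((y + z) / c1) - y - z),
         sqrt ((x + z) / c2) - x - z,
         z + k * z * ((x + y) / (x + y + z)^2 - c3)])"

fun E2 :: "params \<Rightarrow> real^3" where
  "E2 (k, l, c1, c2, c3) =
     vector
       [2 * (c2 + c3 - c1) / (c1 + c2 + c3)^2,
        2 * (c1 + c3 - c2) / (c1 + c2 + c3)^2,
        2 * (c1 + c2 - c3) / (c1 + c2 + c3)^2]"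

definition admissible :: "params set" where
  "admissible =
     {(k, l, c1, c2, c3). c1 > 0 \<and> c2 > 0 \<and> c3 > 0 \<and> k > 0 \<and> 0 \<le> l \<and> l \<le> 1 \<and>
        (\<forall>i. E2 (k, l, c1, c2, c3) $ i > 0)}"

fun PD_ANB :: "params \<Rightarrow> real" where
  "PD_ANB (k, l, c1, c2, c3) =
     k*l*c3^4 + (2*c1*k*l - 10*c2*k*l - 12*c1*k - 2*l)*c3^3
     + (-12*c1*c2*k*l + 4*c2^2*k*l + 4*c1^2*k + 116*c1*c2*k + 2*c1*l + 2*c2*l)*c3^2
     + (-2*c1^3*k*l + 6*c1^2*c2*k*l + 18*c1*c2^2*k*l + 10*c2^3*k*l + 12*c1^3*k
        - 104*c1^2*c2*k - 116*c1*c2^2*k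
        + 10*c1^2*l - 44*c1*c2*l + 10*c2^2*l + 64*c1*c2)*c3
     - c1^4*k*l + 8*c1^3*c2*k*l + 14*c1^2*c2^2*k*l - 5*c2^4*k*l - 4*c1^4*k
     + 4*c1^3*c2*k + 20*c1^2*c2^2*k + 12*c1*c2^3*k
     + 6*c1^3*l - 46*c1^2*c2*l - 46*c1*c2^2*l + 6*c2^3*l + 64*c1^2*c2 + 64*c1*c2^2"

fun PT_ANB_k :: "params \<Rightarrow> real" where
  "PT_ANB_k (k, l, c1, c2, c3) =
     l*c3^3 + (3*c1*l - 9*c2*l - 12*c1)*c3^2
     + (3*c1^2*l - 18*c1*c2*l - 5*c2^2*l - 8*c1^2 + 104*c1*c2)*c3
     + c1^3*l - 9*c1^2*c2*l - 5*c1*c2^2*l + 5*c2^3*l + 4*c1^3 - 8*c1^2*c2 - 12*c1*c2^2"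

fun PT_ANB_l :: "params \<Rightarrow> real" where
  "PT_ANB_l (k, l, c1, c2, c3) =
     k*c3^3 + (c1*k - 11*c2*k - 2)*c3^2
     + (-(c1^2)*k - 2*c1*c2*k + 15*c2^2*k + 4*c1 + 4*c2)*c3
     - c1^3*k + 9*c1^2*c2*k + 5*c1*c2^2*k - 5*c2^3*k + 6*c1^2 - 52*c1*c2 + 6*c2^2"

fun PT_ANB_c1 :: "params \<Rightarrow> real" where
  "PT_ANB_c1 (k, l, c1, c2, c3) =
     k*c3^3 + (-c1*k - 11*c2*k - 2)*c3^2
     + (-(c1^2)*k + 14*c1*c2*k + 15*c2^2*k - 4*c1 + 4*c2)*c3
     + c1^3*k - 3*c1^2*c2*k - 9*c1*c2^2*k - 5*c2^3*k - 2*c1^2 + 4*c1*c2 + 6*c2^2"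

fun PT_ANB_c2 :: "params \<Rightarrow> real" where
  "PT_ANB_c2 (k, l, c1, c2, c3) =
     (k*l + 4*k)*c1^3 + (c2*k*l + c3*k*l + 8*c2*k - 16*c3*k - 6*l)*c1^2
     + (-(c2^2)*k*l + 2*c2*c3*k*l - c3^2*k*l + 4*c2^2*k - 16*c2*c3*k + 12*c3^2*k
        - 4*c2*l - 4*c3*l)*c1
     - c2^3*k*l + c2^2*c3*k*l + c2*c3^2*k*l - c3^3*k*l + 2*c2^2*l + 4*c2*c3*l + 2*c3^2*l"

fun PT_ANB_c3 :: "params \<Rightarrow> real" where
  "PT_ANB_c3 (k, l, c1, c2, c3) =
     l*c3^2 + (-2*c1*l - 2*c2*l)*c3 - 3*c1^2*l + 26*c1*c2*l - 3*c2^2*l - 32*c1*c2"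

end

theory Submission
  imports Defs
begin

text \<open>
  Let \<open>\<chi>\<close> be the characteristic polynomial of the Jacobian matrix at the equilibrium. Then
  \<open>-1 + a\<^sub>2 - a\<^sub>1 + a\<^sub>0 = \<chi>(-1)\<close>, which is \<open>PD_ANB\<close> up to a nonzero factor. At a flip bifurcation \<open>-1\<close> is
  a simple root of \<open>\<chi>\<close>, and differentiating \<open>\<chi>(\<mu>) = 0\<close> shows that transversality forces the partial
  derivatives of \<open>PD_ANB\<close> to be nonzero. The coordinates of the equilibrium do not involve \<open>k\<close> and \<open>l\<close>,
  and in these directions the derivatives are \<open>PT_ANB_k\<close> and \<open>PT_ANB_l\<close> up to nonzero factors.

  In contrast, \<open>PT_ANB_c1\<close>, \<open>PT_ANB_c2\<close>, \<open>PT_ANB_c3\<close> come from the derivatives with the equilibrium held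
  fixed and are not tied to transversality in \<open>c\<^sub>1\<close>, \<open>c\<^sub>2\<close>, \<open>c\<^sub>3\<close>. On the surface \<open>PD_ANB = 0\<close> the vanishing
  of \<open>PT_ANB_c1\<close> implies that of \<open>PT_ANB_l\<close>. The vanishing of \<open>PT_ANB_c2\<close> implies either that of \<open>PT_ANB_l\<close>
  or \<open>l (c\<^sub>1 + c\<^sub>2 + c\<^sub>3) = 8 c\<^sub>1\<close>, and in the second case \<open>\<chi>'(-1) < 0\<close>, which contradicts the eigenvalue
  assignment. Finally \<open>PT_ANB_c3\<close> is negative for all admissible parameters.
\<close>

no_notation fps_nth (infixl "$" 75)

section \<open>Flip conditions for real 3x3 matrices\<close>

lemma charpoly_3:
  fixes A :: "'a::comm_ring_1^3^3"
  shows "charpoly A =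
    [:- det A,
      A$1$1 * A$2$2 - A$1$2 * A$2$1 + (A$1$1 * A$3$3 - A$1$3 * A$3$1) + (A$2$2 * A$3$3 - A$2$3 * A$3$2),
      - (A$1$1 + A$2$2 + A$3$3), 1:]"
  unfolding charpoly_def
  by (simp add: det_3 mat_def map_matrix_def algebra_simps)

lemma eigenvalue_real_iff:
  fixes A :: "real^3^3"
  shows "complex_of_real x \<in># eigenvalues A \<longleftrightarrow> poly (charpoly A) x = 0"
proof -
  have "poly (map_poly complex_of_real (charpoly A)) (complex_of_real x) = complex_of_real (poly (charpoly A) x)"
    by (simp add: charpoly_3 map_poly_pCons)
  moreover have "map_poly complex_of_real (charpoly A) \<noteq> 0"
    by (simp add: charpoly_3 map_poly_pCons)
  ultimately show ?thesis
    by (simp add: eigenvalues_def)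
qed

text \<open>The derivative at \<open>-1\<close> is the product of \<open>1 + \<lambda>\<close> over
  the other two eigenvalues, which is positive for real and conjugate pairs alike in the open unit
  disc.\<close>

lemma flip_eigenvalue_assignment_imp_pderiv_pos:
  fixes A :: "real^3^3"
  assumes "flip_eigenvalue_assignment A"
  shows "poly (charpoly A) (-1) = 0" "poly (pderiv (charpoly A)) (-1) > 0"
proof -
  obtain M where M: "eigenvalues A = add_mset (-1) M" "\<And>z. z \<in># M \<Longrightarrow> cmod z < 1"
    using assms by (auto simp: flip_eigenvalue_assignment_def)
  show root: "poly (charpoly A) (-1) = 0"
    using M(1) eigenvalue_real_iff[of "-1" A] by simp
  obtain a0 a1 a2 where a: "charpoly A = [:a0, a1, a2, 1:]"
    using charpoly_3 by blast
  \<comment> \<open>The quotient by \<open>x + 1\<close> is \<open>x^2 + b x + c\<close>.\<close>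
  define b c where "b = a2 - 1" and "c = a0"
  have p: "charpoly A = [:c, b + c, 1 + b, 1:]"
    using root by (simp add: a b_def c_def)
  show "poly (pderiv (charpoly A)) (-1) > 0"
  proof (rule ccontr)
    assume "\<not> poly (pderiv (charpoly A)) (-1) > 0"
    then have le: "1 + c \<le> b"
      by (simp add: p pderiv_pCons)
    \<comment> \<open>The roots of the quotient are therefore real, and the smaller is at most
      \<open>(- b - \<bar>b - 2\<bar>) / 2 \<le> -1\<close>.\<close>
    have disc: "(b - 2)\<^sup>2 \<le> b\<^sup>2 - 4 * c"
      using le by (simp add: power2_eq_square algebra_simps)
    define w where "w = sqrt (b\<^sup>2 - 4 * c)"
    have ww: "w * w = b\<^sup>2 - 4 * c"
      unfolding w_def using disc by (metis order_trans real_sqrt_mult_self abs_of_nonneg zero_le_power2)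
    have w: "\<bar>b - 2\<bar> \<le> w"
      unfolding w_def using disc by (metis real_sqrt_abs real_sqrt_le_mono)
    define r r' where "r = (- b - w) / 2" and "r' = (- b + w) / 2"
    have r: "r + r' = - b" "r * r' = c"
      using ww by (auto simp: r_def r'_def field_simps power2_eq_square)
    have "map_poly complex_of_real (charpoly A)
        = [:1, 1:] * ([:- complex_of_real r, 1:] * [:- complex_of_real r', 1:])"
    proof -
      have b: "b = - (r + r')" using r by simp
      show ?thesis
        by (simp add: p map_poly_pCons b r(2)[symmetric] algebra_simps)
    qed
    then have "eigenvalues A = {#-1, complex_of_real r, complex_of_real r'#}"
      unfolding eigenvalues_def
      by (simp add: proots_mult del: mult_pCons_left mult_pCons_right)
    then have "complex_of_real r \<in># M"
      using M(1) by simp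
    then have "\<bar>r\<bar> < 1"
      using M(2) by fastforce
    then show False
      using w by (simp add: r_def)
  qed
qed

text \<open>Differentiating \<open>P(m) + t Q(m) = 0\<close> at \<open>t = 0\<close> gives
  \<open>P'(-1) m'(0) + Q(-1) = 0\<close>, and neither factor of the first term vanishes.\<close>

lemma flip_transversality_affine:
  fixes J :: "'p::euclidean_space \<Rightarrow> real^3^3"
  assumes trans: "flip_transversality J u" and b: "b \<in> Basis"
    and affine: "\<And>t. charpoly (J (u + t *\<^sub>R b)) = P + smult t Q"
    and simple: "poly (pderiv P) (-1) \<noteq> 0"
  shows "poly Q (-1) \<noteq> 0"
proof -
  obtain \<mu> D where \<mu>: "\<mu> u = -1" "isCont \<mu> u"
    and ev: "\<forall>\<^sub>F v in nhds u. complex_of_real (\<mu> v) \<in># eigenvalues (J v)"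
    and D: "D \<noteq> 0" "((\<lambda>t. \<bar>\<mu> (u + t *\<^sub>R b)\<bar>) has_real_derivative D) (at 0)"
    using trans b unfolding flip_transversality_def by blast
  define m where "m = (\<lambda>t. \<mu> (u + t *\<^sub>R b))"
  have line: "((\<lambda>t. u + t *\<^sub>R b) \<longlongrightarrow> u) (nhds 0)"
    by (rule tendsto_eq_rhs, (rule tendsto_intros filterlim_ident)+) simp
  have "(\<mu> \<longlongrightarrow> -1) (nhds u)"
    using \<mu> by (metis isCont_def tendsto_at_iff_tendsto_nhds)
  then have "(m \<longlongrightarrow> -1) (nhds 0)"
    unfolding m_def using line by (rule filterlim_compose)
  \<comment> \<open>Near \<open>0\<close> this makes \<open>m = - \<bar>m\<bar>\<close>, so
    \<open>m\<close> inherits differentiability.\<close>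
  then have neg: "\<forall>\<^sub>F t in nhds 0. m t < 0"
    by (rule order_tendstoD) simp
  have "(m has_real_derivative - D) (at 0)"
  proof -
    have "((\<lambda>t. - \<bar>m t\<bar>) has_real_derivative - D) (at 0)"
      using D(2) unfolding m_def by (rule DERIV_minus)
    then show ?thesis
      by (rule DERIV_cong_ev[THEN iffD1, rotated -1]) (use neg in \<open>auto elim: eventually_mono\<close>)
  qed
  then have "((\<lambda>t. poly P (m t) + t * poly Q (m t)) has_real_derivative
      poly (pderiv P) (-1) * - D + poly Q (-1)) (at 0)"
    by (auto intro!: derivative_eq_intros DERIV_chain2[OF poly_DERIV] simp: m_def \<mu>)
  moreover have "\<forall>\<^sub>F t in nhds 0. poly P (m t) + t * poly Q (m t) = 0"
    using filterlim_iff[THEN iffD1, OF line, rule_format, OF ev]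
    by (rule eventually_mono) (simp add: eigenvalue_real_iff affine m_def)
  then have "((\<lambda>t. poly P (m t) + t * poly Q (m t)) has_real_derivative 0) (at 0)"
    by (subst DERIV_cong_ev[OF refl _ refl]) auto
  ultimately have "poly (pderiv P) (-1) * - D + poly Q (-1) = 0"
    by (rule DERIV_unique)
  then show ?thesis
    using simple D(1) by auto
qed

section \<open>The Jacobian matrix at the equilibrium\<close>

lemma has_derivative_vec_nth_iff:
  fixes f :: "'a::real_normed_vector \<Rightarrow> real^'n"
  shows "(f has_derivative f') (at a) \<longleftrightarrow>
    (\<forall>i. ((\<lambda>x. f x $ i) has_derivative (\<lambda>h. f' h $ i)) (at a))"
  by (subst has_derivative_componentwise_within)
     (auto simp: Basis_vec_def inner_axis)

text \<open>\<open>A1\<close> and \<open>A2\<close> are the derivatives of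
  \<open>sqrt (w / c) - w\<close> for \<open>c1\<close> and \<open>c2\<close> at the equilibrium,
  where the root equals \<open>2 / s\<close>.\<close>

definition T_ANB_jacobian :: "params \<Rightarrow> real^3^3" where
  "T_ANB_jacobian = (\<lambda>(k, l, c1, c2, c3).
     let s = c1 + c2 + c3; A1 = s / (4 * c1) - 1; A2 = s / (4 * c2) - 1;
         B = k * (s - 2 * c3) * (s - 4 * c3) / (2 * s)
     in vector [vector [1 - l, l * A1, l * A1],
                vector [A2, 0, A2],
                vector [B, B, 1 - 2 * k * c3 * (s - 2 * c3) / s]])"

lemma eq_jacobian_T_ANB:
  fixes k l c1 c2 c3 :: real
  assumes c: "c1 > 0" "c2 > 0" "c3 > 0"
  shows "eq_jacobian T_ANB E2 (k, l, c1, c2, c3) = T_ANB_jacobian (k, l, c1, c2, c3)" (is "_ = ?J")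
proof -
  define s where "s = c1 + c2 + c3"
  let ?E = "E2 (k, l, c1, c2, c3)"
  have s: "s > 0" using c by (simp add: s_def)
  have yz: "?E $ 2 + ?E $ 3 = 4 * c1 / s\<^sup>2" and xz: "?E $ 1 + ?E $ 3 = 4 * c2 / s\<^sup>2"
    and xy: "?E $ 1 + ?E $ 2 = 4 * c3 / s\<^sup>2" and z: "?E $ 3 = 2 * (s - 2 * c3) / s\<^sup>2"
    by (simp_all add: s_def flip: add_divide_distrib)
  have "?E $ 1 + ?E $ 2 + ?E $ 3 = 2 * s / s\<^sup>2"
    by (simp add: s_def flip: add_divide_distrib)
  then have xyz: "?E $ 1 + ?E $ 2 + ?E $ 3 = 2 / s"
    using s by (simp add: power2_eq_square)
  have sqrt: "sqrt (4 * c / s\<^sup>2 / c) = 2 / s" if "c > 0" for c :: real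
    using that s by (simp add: real_sqrt_divide)
  have J: "?J = vector [vector [1 - l, l * (s / (4 * c1) - 1), l * (s / (4 * c1) - 1)],
      vector [s / (4 * c2) - 1, 0, s / (4 * c2) - 1],
      vector [k * (s - 2 * c3) * (s - 4 * c3) / (2 * s), k * (s - 2 * c3) * (s - 4 * c3) / (2 * s),
        1 - 2 * k * c3 * (s - 2 * c3) / s]]"
    by (simp add: T_ANB_jacobian_def Let_def s_def)
  have "(T_ANB (k, l, c1, c2, c3) has_derivative (\<lambda>h. ?J *v h)) (at ?E)"
    unfolding has_derivative_vec_nth_iff forall_3
  proof (intro conjI)
    show "((\<lambda>v. T_ANB (k, l, c1, c2, c3) v $ 1) has_derivative (\<lambda>h. (?J *v h) $ 1)) (at ?E)"
      unfolding T_ANB.simps Let_def vector_3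
      using c s sqrt[OF c(1)]
      by (auto intro!: derivative_eq_intros bounded_linear.has_derivative[OF bounded_linear_vec_nth]
          simp: yz simp del: E2.simps)
        (simp add: matrix_vector_mult_def sum_3 J fun_eq_iff field_simps del: E2.simps)
    show "((\<lambda>v. T_ANB (k, l, c1, c2, c3) v $ 2) has_derivative (\<lambda>h. (?J *v h) $ 2)) (at ?E)"
      unfolding T_ANB.simps Let_def vector_3
      using c s sqrt[OF c(2)]
      by (auto intro!: derivative_eq_intros bounded_linear.has_derivative[OF bounded_linear_vec_nth]
          simp: xz simp del: E2.simps)
        (simp add: matrix_vector_mult_def sum_3 J fun_eq_iff field_simps del: E2.simps)
    show "((\<lambda>v. T_ANB (k, l, c1, c2, c3) v $ 3) has_derivative (\<lambda>h. (?J *v h) $ 3)) (at ?E)"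
      unfolding T_ANB.simps Let_def vector_3
      using c s
      by (auto intro!: derivative_eq_intros bounded_linear.has_derivative[OF bounded_linear_vec_nth]
          simp: xyz simp del: E2.simps)
        (simp add: xy z matrix_vector_mult_def sum_3 J fun_eq_iff del: E2.simps,
         simp add: field_simps power2_eq_square power4_eq_xxxx)
  qed
  then have "frechet_derivative (T_ANB (k, l, c1, c2, c3)) (at ?E) = (\<lambda>h. ?J *v h)"
    by (rule frechet_derivative_at[symmetric])
  then show ?thesis
    by (simp add: eq_jacobian_def jacobian_def matrix_of_matrix_vector_mul)
qed

section \<open>The characteristic polynomial at \<open>-1\<close>\<close>

lemma charpoly_T_ANB_form:
  fixes l p A2 B C :: real
  shows "charpoly (vector [vector [1 - l, p, p], vector [A2, 0, A2], vector [B, B, C]] :: real^3^3) =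
    [:(1 - l) * A2 * B + p * A2 * C - 2 * p * A2 * B,
      (1 - l) * C - p * A2 - p * B - A2 * B, - (1 - l + C), 1:]"
  by (simp add: charpoly_3 det_3 algebra_simps)

lemma poly_charpoly_T_ANB_jacobian:
  fixes k l c1 c2 c3 :: real
  assumes c: "c1 > 0" "c2 > 0" "c3 > 0"
  shows "16 * (c1 + c2 + c3) * c1 * c2 * poly (charpoly (T_ANB_jacobian (k, l, c1, c2, c3))) (-1)
    = - PD_ANB (k, l, c1, c2, c3)"
proof -
  define s where "s = c1 + c2 + c3"
  define A1 A2 B C where "A1 = s / (4 * c1) - 1" and "A2 = s / (4 * c2) - 1"
    and "B = k * (s - 2 * c3) * (s - 4 * c3) / (2 * s)" and "C = 1 - 2 * k * c3 * (s - 2 * c3) / s"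
  have s: "s > 0" using c by (simp add: s_def)
  define q where "q = (1 - l) * A2 * B + l * A1 * A2 * C - 2 * (l * A1) * A2 * B
      - ((1 - l) * C - l * A1 * A2 - l * A1 * B - A2 * B) - (1 - l + C) - 1"
  have J: "T_ANB_jacobian (k, l, c1, c2, c3) =
     vector [vector [1 - l, l * A1, l * A1], vector [A2, 0, A2], vector [B, B, C]]"
    by (simp add: T_ANB_jacobian_def Let_def A1_def A2_def B_def C_def s_def)
  have q: "poly (charpoly (T_ANB_jacobian (k, l, c1, c2, c3))) (-1) = q"
    unfolding J charpoly_T_ANB_form q_def by simp
  \<comment> \<open>Opaque numerators let the denominators be cleared before anything is expanded in
    the parameters.\<close>
  obtain a b e f where a: "a = s - 4 * c1" and b: "b = s - 4 * c2"
    and e: "e = k * (s - 2 * c3) * (s - 4 * c3)" and f: "f = s - 2 * k * c3 * (s - 2 * c3)"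
    by blast
  have AB: "A1 = a / (4 * c1)" "A2 = b / (4 * c2)" "B = e / (2 * s)" "C = f / s"
    using c s by (simp_all add: A1_def A2_def B_def C_def a b e f field_simps)
  have "16 * s * c1 * c2 * q = (2 - l) * 2 * c1 * b * e + l * a * b * (s + f) - l * a * b * e
      + 2 * l * c2 * a * e - 16 * (2 - l) * c1 * c2 * (s + f)"
    unfolding q_def AB using c s by (simp add: field_simps)
  also have "\<dots> = - PD_ANB (k, l, c1, c2, c3)"
    unfolding a b e f s_def by (simp add: algebra_simps power2_eq_square power3_eq_cube power4_eq_xxxx)
  finally show ?thesis by (simp add: q s_def)
qed

text \<open>\<open>PD_ANB\<close> is affine in \<open>k\<close>, so a unit step gives the partial
  derivative.\<close>

lemma PD_ANB_diff_k:
  "PD_ANB (k + 1, l, c1, c2, c3) - PD_ANB (k, l, c1, c2, c3)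
    = - (c1 + c2 - c3) * PT_ANB_k (k, l, c1, c2, c3)"
  by (simp add: algebra_simps power2_eq_square power3_eq_cube power4_eq_xxxx)

lemma PD_ANB_diff_l:
  "PD_ANB (k, l + 1, c1, c2, c3) - PD_ANB (k, l, c1, c2, c3)
    = (c1 + c2 + c3) * PT_ANB_l (k, l, c1, c2, c3)"
  by (simp add: algebra_simps power2_eq_square power3_eq_cube power4_eq_xxxx)

section \<open>Relations and signs of the condition polynomials\<close>

text \<open>Expand the determinant of the Jacobian matrix plus the identity along its first row.
  \<open>PT_ANB_c1\<close> is a multiple of the sum of the (1,2) and (1,3) cofactors; eliminate the
  (1,1) cofactor between the determinant and its derivative in \<open>l\<close>.\<close>

lemma PT_ANB_l_eq_PT_ANB_c1:
  "(c1 + c2 + c3) * (2 - l) * PT_ANB_l (k, l, c1, c2, c3)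
    = 2 * (c2 + c3 - 3 * c1) * PT_ANB_c1 (k, l, c1, c2, c3) - PD_ANB (k, l, c1, c2, c3)"
  by (simp add: algebra_simps power2_eq_square power3_eq_cube power4_eq_xxxx)

text \<open>
  For the Jacobian matrix plus the identity, \<open>PT_ANB_c2\<close> is a multiple of the sum of the
  \<open>(2,1)\<close> and \<open>(2,3)\<close> cofactors, \<open>PT_ANB_c3\<close> of the \<open>(3,3)\<close> cofactor, and \<open>PD_ANB\<close> of the determinant;
  eliminating the \<open>(3,3)\<close> entry between the first and the last yields this factorisation.
\<close>

lemma PT_ANB_c2_factorisation:
  "2 * c2 * k * (c1 + c2 - c3) * (c1 + c2 - 3 * c3) * (l * (c1 + c2 + c3) - 8 * c1)\<^sup>2
    = - PT_ANB_c3 (k, l, c1, c2, c3) * PT_ANB_c2 (k, l, c1, c2, c3)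
      - l * (c2 + c3 - 3 * c1) * PD_ANB (k, l, c1, c2, c3)"
  by (simp add: algebra_simps power2_eq_square power3_eq_cube power4_eq_xxxx)

lemma PT_ANB_c3_neg:
  fixes k l c1 c2 c3 :: real
  assumes "c1 > 0" "c2 > 0" "c1 < c2 + c3" "c2 < c1 + c3" "c3 < c1 + c2" "0 \<le> l" "l \<le> 1"
  shows "PT_ANB_c3 (k, l, c1, c2, c3) < 0"
proof -
  let ?s = "c1 + c2 + c3"
  have *: "PT_ANB_c3 (k, l, c1, c2, c3) = l * ((?s - 4 * c1) * (?s - 4 * c2)) - 16 * (c1 * c2) * (2 - l)"
    by (simp add: algebra_simps power2_eq_square)
  have cc: "c1 * c2 > 0" using assms by simp
  have "(?s - 4 * c1) * (?s - 4 * c2) \<le> 4 * (c1 * c2)"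
  proof (cases "(?s - 4 * c1) * (?s - 4 * c2) \<le> 0")
    case False
    \<comment> \<open>Both factors cannot be positive, since their sum is
      \<open>2 * (c3 - c1 - c2)\<close>.\<close>
    then have "?s - 4 * c1 < 0 \<and> ?s - 4 * c2 < 0"
      using assms by (auto simp: not_le zero_less_mult_iff)
    then have "(4 * c1 - ?s) * (4 * c2 - ?s) \<le> (2 * c1) * (2 * c2)"
      using assms by (intro mult_mono) auto
    then show ?thesis by (simp add: algebra_simps)
  qed (use cc in linarith)
  then have "l * ((?s - 4 * c1) * (?s - 4 * c2)) \<le> 1 * (4 * (c1 * c2))"
    using assms cc by (meson mult_left_mono mult_right_mono order_trans zero_le_numeral less_imp_le mult_nonneg_nonneg)
  moreover have "16 * (c1 * c2) * (2 - l) \<ge> 16 * (c1 * c2) * 1"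
    using assms cc by (intro mult_left_mono) auto
  ultimately show ?thesis using * cc by linarith
qed

section \<open>Consequences of a flip bifurcation\<close>

text \<open>Only the third row involves \<open>k\<close> and only the first involves
  \<open>l\<close>, each affinely, and a determinant is affine in each row.\<close>

lemma charpoly_T_ANB_jacobian_affine:
  "charpoly (T_ANB_jacobian (k + t, l, c1, c2, c3)) = charpoly (T_ANB_jacobian (k, l, c1, c2, c3))
     + smult t (charpoly (T_ANB_jacobian (k + 1, l, c1, c2, c3)) - charpoly (T_ANB_jacobian (k, l, c1, c2, c3)))"
    (is ?k)
  "charpoly (T_ANB_jacobian (k, l + t, c1, c2, c3)) = charpoly (T_ANB_jacobian (k, l, c1, c2, c3))
     + smult t (charpoly (T_ANB_jacobian (k, l + 1, c1, c2, c3)) - charpoly (T_ANB_jacobian (k, l, c1, c2, c3)))"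
    (is ?l)
proof -
  define s where "s = c1 + c2 + c3"
  obtain A1 A2 B C where
    "A1 = s / (4 * c1) - 1" "A2 = s / (4 * c2) - 1"
    "B = (s - 2 * c3) * (s - 4 * c3) / (2 * s)" "C = 2 * c3 * (s - 2 * c3) / s"
    by blast
  then have J: "T_ANB_jacobian (k, l, c1, c2, c3) =
     vector [vector [1 - l, l * A1, l * A1], vector [A2, 0, A2], vector [k * B, k * B, 1 - k * C]]" for k l
    by (simp add: T_ANB_jacobian_def Let_def s_def mult_ac)
  show ?k ?l
    unfolding J charpoly_T_ANB_form by (simp_all add: algebra_simps)
qed

lemma flip_bifurcation_T_ANB_imp:
  fixes k l c1 c2 c3 :: real
  assumes c: "c1 > 0" "c2 > 0" "c3 > 0"
    and flip: "flip_bifurcation T_ANB E2 (k, l, c1, c2, c3)"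
  shows "PD_ANB (k, l, c1, c2, c3) = 0"
    and "poly (pderiv (charpoly (T_ANB_jacobian (k, l, c1, c2, c3)))) (-1) > 0"
    and "PT_ANB_k (k, l, c1, c2, c3) \<noteq> 0"
    and "PT_ANB_l (k, l, c1, c2, c3) \<noteq> 0"
proof -
  note J = eq_jacobian_T_ANB[OF c] and p = poly_charpoly_T_ANB_jacobian[OF c]
  have assign: "flip_eigenvalue_assignment (T_ANB_jacobian (k, l, c1, c2, c3))"
    and trans: "flip_transversality (eq_jacobian T_ANB E2) (k, l, c1, c2, c3)"
    using flip by (simp_all add: flip_bifurcation_def J)
  note simple = flip_eigenvalue_assignment_imp_pderiv_pos[OF assign]
  show "PD_ANB (k, l, c1, c2, c3) = 0"
    using p[of k l] simple(1) by simp
  show "poly (pderiv (charpoly (T_ANB_jacobian (k, l, c1, c2, c3)))) (-1) > 0"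
    by (rule simple(2))
  have k: "16 * (c1 + c2 + c3) * c1 * c2 *
      poly (charpoly (T_ANB_jacobian (k + 1, l, c1, c2, c3)) - charpoly (T_ANB_jacobian (k, l, c1, c2, c3))) (-1)
      = (c1 + c2 - c3) * PT_ANB_k (k, l, c1, c2, c3)"
    using PD_ANB_diff_k[of k l c1 c2 c3]
    unfolding poly_diff right_diff_distrib p by linarith
  \<comment> \<open>Along this direction \<open>c1, c2, c3\<close> stay fixed, so the explicit
    matrix is valid for every \<open>t\<close>.\<close>
  have "poly (charpoly (T_ANB_jacobian (k + 1, l, c1, c2, c3)) - charpoly (T_ANB_jacobian (k, l, c1, c2, c3))) (-1) \<noteq> 0"
    by (rule flip_transversality_affine[OF trans, where b = "(1, 0, 0, 0, 0)"
          and P = "charpoly (T_ANB_jacobian (k, l, c1, c2, c3))"])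
       (use simple(2) in \<open>simp_all add: Basis_prod_def zero_prod_def J flip: charpoly_T_ANB_jacobian_affine(1)\<close>)
  then show "PT_ANB_k (k, l, c1, c2, c3) \<noteq> 0"
    using k c by auto
  have l: "16 * (c1 + c2 + c3) * c1 * c2 *
      poly (charpoly (T_ANB_jacobian (k, l + 1, c1, c2, c3)) - charpoly (T_ANB_jacobian (k, l, c1, c2, c3))) (-1)
      = - (c1 + c2 + c3) * PT_ANB_l (k, l, c1, c2, c3)"
    using PD_ANB_diff_l[of k l c1 c2 c3]
    unfolding poly_diff right_diff_distrib p by linarith
  have "poly (charpoly (T_ANB_jacobian (k, l + 1, c1, c2, c3)) - charpoly (T_ANB_jacobian (k, l, c1, c2, c3))) (-1) \<noteq> 0"
    by (rule flip_transversality_affine[OF trans, where b = "(0, 1, 0, 0, 0)"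
          and P = "charpoly (T_ANB_jacobian (k, l, c1, c2, c3))"])
       (use simple(2) in \<open>simp_all add: Basis_prod_def zero_prod_def J flip: charpoly_T_ANB_jacobian_affine(2)\<close>)
  then show "PT_ANB_l (k, l, c1, c2, c3) \<noteq> 0"
    using l c by auto
qed

lemma PT_ANB_c2_nonzero:
  fixes k l c1 c2 c3 :: real
  assumes c: "c1 > 0" "c2 > 0" "c3 > 0" "k > 0" and l: "0 \<le> l" "l \<le> 1"
    and tri: "c1 < c2 + c3" "c2 < c1 + c3" "c3 < c1 + c2"
    and PD: "PD_ANB (k, l, c1, c2, c3) = 0"
    and PT_l: "PT_ANB_l (k, l, c1, c2, c3) \<noteq> 0"
    and simple: "poly (pderiv (charpoly (T_ANB_jacobian (k, l, c1, c2, c3)))) (-1) > 0"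
  shows "PT_ANB_c2 (k, l, c1, c2, c3) \<noteq> 0"
proof
  assume PT: "PT_ANB_c2 (k, l, c1, c2, c3) = 0"
  define s where "s = c1 + c2 + c3"
  have s: "s > 0" using c by (simp add: s_def)
  \<comment> \<open>Expanding along the second row leaves the (2,2) cofactor of the Jacobian matrix
    plus the identity, scaled by \<open>16 * s * c1 * c2\<close>.\<close>
  have "PD_ANB (k, l, c1, c2, c3) + (s - 4 * c2) * PT_ANB_c2 (k, l, c1, c2, c3) =
      16 * c1 * c2 * (2 - l) * (2 * s - 2 * k * c3 * (s - 2 * c3))
      - 2 * c2 * l * k * (s - 4 * c1) * (s - 2 * c3) * (s - 4 * c3)"
    unfolding s_def by (simp add: algebra_simps power2_eq_square power3_eq_cube power4_eq_xxxx)
  then have R: "16 * c1 * c2 * (2 - l) * (2 * s - 2 * k * c3 * (s - 2 * c3)) =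
      2 * c2 * l * k * (s - 4 * c1) * (s - 2 * c3) * (s - 4 * c3)"
    using PD PT by simp
  have "2 * c2 * k * (c1 + c2 - c3) * (c1 + c2 - 3 * c3) * (l * (c1 + c2 + c3) - 8 * c1)^2 = 0"
    unfolding PT_ANB_c2_factorisation PD PT by simp
  then consider "s = 4 * c3" | "l * s = 8 * c1"
    using c tri by (auto simp: s_def)
  then show False
  proof cases
    case 1
    \<comment> \<open>Here the (3,1) and (3,2) entries vanish, and \<open>R\<close> forces
      \<open>k * c3 = 2\<close>, which annihilates \<open>PT_ANB_l\<close>.\<close>
    then have "8 * c3 - 2 * k * c3 * (2 * c3) = 0"
      using R c l by simp
    then have "k * c3 = 2"
      using c by (simp add: algebra_simps)
    moreover have c1: "c1 = 3 * c3 - c2"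
      using 1 by (simp add: s_def)
    have "PT_ANB_l (k, l, c1, c2, c3) = 16 * (k * c3 - 2) * (c1 * c2 + (c3 - c1) * (c3 - c2))"
      unfolding c1 by (simp add: algebra_simps power2_eq_square power3_eq_cube)
    ultimately show False
      using PT_l by simp
  next
    case 2
    txt \<open>
      \<open>\<chi>'(-1) = (1 + \<lambda>\<^sub>2) (1 + \<lambda>\<^sub>3) < 0\<close>, so that one of the other two eigenvalues lies below \<open>-1\<close>.
    \<close>
    have lA1: "l * (s - 4 * c1) = 4 * c1 * (2 - l)"
      using 2 by (simp add: algebra_simps)
    have "(8 * c1 * c2 * (2 - l)) * (4 * s - 4 * k * c3 * (s - 2 * c3)) =
        (8 * c1 * c2 * (2 - l)) * (k * (s - 2 * c3) * (s - 4 * c3))"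
    proof -
      have "(8 * c1 * c2 * (2 - l)) * (4 * s - 4 * k * c3 * (s - 2 * c3)) =
          16 * c1 * c2 * (2 - l) * (2 * s - 2 * k * c3 * (s - 2 * c3))"
        by (simp add: algebra_simps)
      also have "\<dots> = 2 * c2 * k * (l * (s - 4 * c1)) * (s - 2 * c3) * (s - 4 * c3)"
        unfolding R by simp
      finally show ?thesis
        unfolding lA1 by (simp add: mult.assoc)
    qed
    \<comment> \<open>In terms of the matrix, the (3,3) entry plus one equals the (3,1)
      entry.\<close>
    then have "4 * s - 4 * k * c3 * (s - 2 * c3) = k * (s - 2 * c3) * (s - 4 * c3)"
      using c l by simp
    then have "s * (k * (s - 2 * c3)) = s * 4"
      by (simp add: algebra_simps)
    then have k: "k * (s - 2 * c3) = 4"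
      using s by simp
    define A2 B where "A2 = s / (4 * c2) - 1" and "B = 2 - 8 * c3 / s"
    have "l * (s / (4 * c1) - 1) = l * (s - 4 * c1) / (4 * c1)"
      using c by (simp add: field_simps)
    also have "\<dots> = 2 - l"
      using lA1 c by simp
    finally have e1: "l * (s / (4 * c1) - 1) = 2 - l" .
    have e2: "k * (s - 2 * c3) * (s - 4 * c3) / (2 * s) = B"
      unfolding k B_def using s by (simp add: field_simps)
    have "2 * k * c3 * (s - 2 * c3) = 2 * c3 * (k * (s - 2 * c3))"
      by simp
    then have e3: "1 - 2 * k * c3 * (s - 2 * c3) / s = B - 1"
      unfolding k B_def by simp
    have "T_ANB_jacobian (k, l, c1, c2, c3) =
      vector [vector [1 - l, 2 - l, 2 - l], vector [A2, 0, A2], vector [B, B, B - 1]]"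
      by (simp only: T_ANB_jacobian_def Let_def case_prod_conv A2_def e1 e2 e3 flip: s_def)
    then have "poly (pderiv (charpoly (T_ANB_jacobian (k, l, c1, c2, c3)))) (-1) = (1 - A2) * (2 - l + B)"
      by (simp only: charpoly_T_ANB_form) (simp add: pderiv_pCons algebra_simps)
    moreover have "A2 < 0"
    proof -
      \<comment> \<open>With \<open>s < 2 * (c1 + c2)\<close> this gives \<open>3 * c1 < c2\<close>,
        hence \<open>s < 4 * c2\<close>.\<close>
      have "8 * c1 \<le> 1 * s"
        using 2 l s by (metis mult_right_mono less_imp_le)
      then show ?thesis
        using c tri by (simp add: A2_def s_def field_simps)
    qed
    moreover have "2 - l + B < 0"
    proof -
      have "4 * s - l * s < 8 * c3"
        using 2 tri by (simp add: s_def)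
      then show ?thesis
        using s by (simp add: B_def field_simps)
    qed
    ultimately show False
      using simple by (simp add: zero_less_mult_iff)
  qed
qed

section \<open>The bifurcation surface and the five conditions\<close>

theorem theorem4:
  "flip_surface T_ANB E2 admissible = {u \<in> admissible. PD_ANB u = 0} \<and>
   (\<forall>u\<in>admissible. flip_bifurcation T_ANB E2 u \<longrightarrow>
      PT_ANB_k u \<noteq> 0 \<and> PT_ANB_l u \<noteq> 0 \<and>
      PT_ANB_c1 u \<noteq> 0 \<and> PT_ANB_c2 u \<noteq> 0 \<and> PT_ANB_c3 u \<noteq> 0)"
proof (intro conjI ballI impI)
  have "(let a = coeff (charpoly (eq_jacobian T_ANB E2 u)) in -1 + a 2 - a 1 + a 0 = 0) \<longleftrightarrow> PD_ANB u = 0"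
    if "u \<in> admissible" for u
  proof -
    obtain k l c1 c2 c3 where u: "u = (k, l, c1, c2, c3)"
      by (cases u)
    with that have c: "c1 > 0" "c2 > 0" "c3 > 0"
      by (auto simp: admissible_def)
    obtain a0 a1 a2 where a: "charpoly (T_ANB_jacobian u) = [:a0, a1, a2, 1:]"
      using charpoly_3 by blast
    have "- PD_ANB u = 16 * (c1 + c2 + c3) * c1 * c2 * (-1 + a2 - a1 + a0)"
      using poly_charpoly_T_ANB_jacobian[OF c, of k l] a by (simp add: u algebra_simps del: PD_ANB.simps)
    then show ?thesis
      using c by (auto simp: eq_jacobian_T_ANB[OF c] u a[unfolded u] numeral_2_eq_2 simp del: PD_ANB.simps)
  qed
  then show "flip_surface T_ANB E2 admissible = {u \<in> admissible. PD_ANB u = 0}"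
    unfolding flip_surface_def by blast
next
  fix u
  assume adm: "u \<in> admissible" and flip: "flip_bifurcation T_ANB E2 u"
  obtain k l c1 c2 c3 where u: "u = (k, l, c1, c2, c3)"
    by (cases u)
  have c: "c1 > 0" "c2 > 0" "c3 > 0" "k > 0" and l: "0 \<le> l" "l \<le> 1"
    and pos: "\<And>i. E2 (k, l, c1, c2, c3) $ i > 0"
    using adm unfolding u admissible_def by blast+
  \<comment> \<open>Positivity of the equilibrium amounts to the strict triangle
    inequalities.\<close>
  have tri: "c1 < c2 + c3" "c2 < c1 + c3" "c3 < c1 + c2"
    using pos[of 1] pos[of 2] pos[of 3] c by (auto simp: zero_less_divide_iff)
  note F = flip_bifurcation_T_ANB_imp[OF c(1-3) flip[unfolded u]]
  show "PT_ANB_k u \<noteq> 0" "PT_ANB_l u \<noteq> 0"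
    using F(3,4) unfolding u .
  show "PT_ANB_c1 u \<noteq> 0"
    using PT_ANB_l_eq_PT_ANB_c1[of c1 c2 c3 l k] F(1,4) c l
    unfolding u by (auto simp del: PD_ANB.simps PT_ANB_l.simps PT_ANB_c1.simps)
  show "PT_ANB_c2 u \<noteq> 0"
    unfolding u by (rule PT_ANB_c2_nonzero[OF c l tri F(1,4,2)])
  show "PT_ANB_c3 u \<noteq> 0"
    using PT_ANB_c3_neg[OF c(1,2) tri l, of k] unfolding u by simp
qed

end
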